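(* Let $a(n)$ be the number of $1$'s in $b_1 b_2 \cdots b_n$. Then the limit $\alpha = \lim_{n \to \infty} a(n)/n$ exists and equals $2 - 2\sum_{i \geq 1} b_i 2^{-i}$.
   Context: Define finite binary words $B_i$ by $B_1 = 101$ and $B_{i+1} = B_i C_i$ for $i \geq 1$, where $C_i$ is the word obtained from $B_i$ by removing its first $i$ symbols. Since each $B_i$ is a prefix of $B_{i+1}$, there is a unique infinite binary word $\mathbf{b} = b_1 b_2 b_3 \cdots$ (with $b_i \in \{0,1\}$) of which every $B_i$ is a prefix. *)

theory Defs
  imports Complex_Main "HOL-Library.Stream" "HOL-Library.Sublist"
begin

text \<open>
  Binary words are lists over \<^typ>\<open>bool\<close>, with \<^const>\<open>True\<close> for the symbol 1 and \<^const>\<open>False\<close> for 0.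
  The words are indexed from 1; \<open>B 0\<close> is a dummy value.
\<close>

fun B :: "nat \<Rightarrow> bool list" where
  "B 0 = []"
| "B (Suc 0) = [True, False, True]"
| "B (Suc (Suc n)) = B (Suc n) @ drop (Suc n) (B (Suc n))"

definition b_word :: "bool stream" where
  "b_word = (THE w. \<forall>i\<ge>1. stake (length (B i)) w = B i)"

text \<open>The symbols \<open>b 1, b 2, \<dots>\<close> as numbers; stream positions start at 0, hence the shift.\<close>

definition b :: "nat \<Rightarrow> nat" where
  "b n = of_bool (b_word !! (n - 1))"

definition a :: "nat \<Rightarrow> nat" where
  "a n = card {k \<in> {1..n}. b k = 1}"

lemma B_rec: "i \<ge> 1 \<Longrightarrow> B (i + 1) = B i @ drop i (B i)"
  by (cases i) auto

lemma length_B: "i \<ge> 1 \<Longrightarrow> length (B i) \<ge> i + 2"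
  by (induction i rule: B.induct) auto

lemma prefix_B:
  assumes "1 \<le> i" "i \<le> j"
  shows "prefix (B i) (B j)"
  using assms(2)
proof (induction j rule: dec_induct)
  case (step n)
  then have "prefix (B n) (B (Suc n))"
    using B_rec[of n] assms(1) by simp
  then show ?case using step.IH by (rule prefix_order.trans[rotated])
qed simp

lemma ex1_b_word: "\<exists>!w. \<forall>i\<ge>1. stake (length (B i)) w = B i"
proof (rule ex1I)
  let ?w = "smap (\<lambda>n. B (Suc n) ! n) (fromN 0)"
  show "\<forall>i\<ge>1. stake (length (B i)) ?w = B i"
  proof (intro allI impI nth_equalityI)
    fix i k :: nat
    assume i: "i \<ge> 1" and k: "k < length (stake (length (B i)) ?w)"
    have k1: "k < length (B i)" "k < length (B (Suc k))"
      using k length_B[of "Suc k"] by simp_all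
    have "B (Suc k) ! k = B i ! k"
    proof (cases "Suc k \<le> i")
      case True
      then show ?thesis using prefix_B[of "Suc k" i] k1 by (auto simp: prefix_def nth_append)
    next
      case False
      then show ?thesis using prefix_B[of i "Suc k"] i k1 by (auto simp: prefix_def nth_append)
    qed
    then show "stake (length (B i)) ?w ! k = B i ! k" using k1 by simp
  qed simp
next
  fix w
  assume w: "\<forall>i\<ge>1. stake (length (B i)) w = B i"
  have "w !! n = B (Suc n) ! n" for n
    using w length_B[of "Suc n"] stake_nth[of n "length (B (Suc n))" w] by simp
  then have "smap (\<lambda>n. B (Suc n) ! n) (fromN 0) = w"
    by (simp add: smap_alt)
  then show "w = smap (\<lambda>n. B (Suc n) ! n) (fromN 0)" ..
qed

lemma stake_b_word: "i \<ge> 1 \<Longrightarrow> stake (length (B i)) b_word = B i"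
  using theI'[OF ex1_b_word] unfolding b_word_def by blast

end

theory Submission
  imports Defs "HOL-Real_Asymp.Real_Asymp"
begin

text \<open>
  Let \<open>s\<close> be the value of the binary expansion \<open>0.b\<^sub>1b\<^sub>2\<dots>\<close> and \<open>s\<^sub>i\<close> that of its truncation after \<open>i\<close>
  digits. From \<open>B\<^sub>i\<^sub>+\<^sub>1 = B\<^sub>i C\<^sub>i\<close> one gets \<open>|B\<^sub>i| = 2\<^sup>i\<^sup>-\<^sup>1 + i + 1\<close>, and the number of 1's in \<open>B\<^sub>i\<close>
  is \<open>2\<^sup>i (1 - s\<^sub>i) + a(i)\<close>. Since \<open>s - s\<^sub>i \<le> 2\<^sup>-\<^sup>i\<close>, the discrepancy \<open>a(n) - (2 - 2s) n\<close> at
  \<open>n = |B\<^sub>i|\<close> is \<open>O(i)\<close>. The self-similarity \<open>b\<^bsub>|B\<^sub>i|+k\<^esub> = b\<^bsub>i+k\<^esub>\<close> passes from \<open>n \<le> |B\<^sub>i|\<close> to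
  \<open>n \<le> |B\<^sub>i\<^sub>+\<^sub>1|\<close> at an additional cost of \<open>O(i)\<close>, so the discrepancy at every \<open>n\<close> is
  \<open>O((log n)\<^sup>2)\<close>.
\<close>

lemma length_B_closed_form: "length (B (Suc i)) = 2 ^ i + i + 2"
proof (induction i)
  case (Suc i)
  have "length (B (Suc (Suc i))) = 2 * length (B (Suc i)) - Suc i"
    using length_B[of "Suc i"] by simp
  also have "\<dots> = 2 ^ Suc i + Suc i + 2"
    unfolding Suc.IH by simp
  finally show ?case .
qed simp

lemma b_eq_nth_B:
  assumes "i \<ge> 1" "k < length (B i)"
  shows "b (Suc k) = of_bool (B i ! k)"
  using stake_nth[OF assms(2), of b_word] stake_b_word[OF assms(1)] by (simp add: b_def)

lemma b_le_1: "b n \<le> 1"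
  by (simp add: b_def)

lemma a_0 [simp]: "a 0 = 0"
  by (simp add: a_def)

lemma a_Suc [simp]: "a (Suc n) = a n + b (Suc n)"
proof -
  have "a m = (\<Sum>k = 1..m. b k)" for m
  proof -
    have "(\<Sum>k = 1..m. b k) = (\<Sum>k = 1..m. if b k = 1 then 1 else 0)"
      by (rule sum.cong) (auto simp: b_def)
    then show ?thesis
      by (simp add: a_def flip: sum.inter_filter)
  qed
  then show ?thesis
    by simp
qed

lemma a_le: "a n \<le> n"
proof (induction n)
  case (Suc n)
  then show ?case
    using b_le_1[of "Suc n"] by simp
qed simp

text \<open>At list index \<open>length (B i) + k\<close>, \<open>B (Suc i)\<close> reads index
  \<open>k\<close> of the appended \<open>drop i (B i)\<close>, hence index \<open>i + k\<close> of
  \<open>B i\<close>.\<close>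

lemma b_shift:
  assumes "i \<ge> 1" "i + k < length (B i)"
  shows "b (Suc (length (B i) + k)) = b (Suc (i + k))"
proof -
  have "B (Suc i) = B i @ drop i (B i)"
    using B_rec[OF assms(1)] by simp
  moreover from this have "length (B i) + k < length (B (Suc i))"
    using assms by simp
  ultimately show ?thesis
    using assms b_eq_nth_B[of "Suc i" "length (B i) + k"] b_eq_nth_B[of i "i + k"]
    by (simp add: nth_append)
qed

lemma a_shift:
  assumes "i \<ge> 1" "i + m \<le> length (B i)"
  shows "a (length (B i) + m) + a i = a (length (B i)) + a (i + m)"
  using assms(2)
proof (induction m)
  case (Suc m)
  then show ?case
    using b_shift[OF assms(1), of m] by simp
qed simp

text \<open>The difference \<open>x i = a (length (B i)) - a i\<close> obeys
  \<open>x (Suc i) = 2 * x i - b (Suc i)\<close>, so \<open>x i / 2 ^ i\<close> loses one binary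
  digit of \<open>b_value\<close> per step, starting from \<open>x 1 / 2 = 1 / 2\<close>.\<close>

lemma a_length_B:
  assumes "i \<ge> 1"
  shows "real (a (length (B i))) = 2 ^ i * (1 - (\<Sum>k<i. real (b (Suc k)) / 2 ^ Suc k)) + real (a i)"
  using assms
proof (induction i rule: dec_induct)
  case base
  have "b (Suc 0) = 1" "b (Suc (Suc 0)) = 0" "b (Suc (Suc (Suc 0))) = 1"
    by (simp_all add: b_eq_nth_B[of 1])
  then show ?case
    by (simp add: numeral_3_eq_3)
next
  case (step i)
  have "length (B (Suc i)) = length (B i) + (length (B i) - i)"
    using B_rec[OF step.hyps(1)] by simp
  then have "a (length (B (Suc i))) + a i = 2 * a (length (B i))"
    using a_shift[OF step.hyps(1), of "length (B i) - i"] length_B[OF step.hyps(1)] by simp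
  then have "real (a (length (B (Suc i)))) = 2 * real (a (length (B i))) - real (a i)"
    by linarith
  then show ?case
    unfolding step.IH by (simp add: algebra_simps)
qed

definition b_value :: real where
  "b_value = (\<Sum>k. real (b (Suc k)) / 2 ^ Suc k)"

lemma summable_b: "summable (\<lambda>k. real (b (Suc k)) / 2 ^ Suc k)"
proof (rule summable_comparison_test)
  show "summable (\<lambda>k. (1 / 2 :: real) ^ Suc k)"
    using power_half_series by (rule sums_summable)
  show "\<exists>N. \<forall>n\<ge>N. norm (real (b (Suc n)) / 2 ^ Suc n) \<le> (1 / 2) ^ Suc n"
    by (auto simp: b_def power_one_over)
qed

text \<open>The tail is dominated by a geometric series with sum \<open>1 / 2 ^ i\<close>. The case
  \<open>i = 0\<close> places \<open>b_value\<close> in [0, 1].\<close>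

lemma b_value_truncation:
  "0 \<le> 2 ^ i * (b_value - (\<Sum>k<i. real (b (Suc k)) / 2 ^ Suc k))"
  "2 ^ i * (b_value - (\<Sum>k<i. real (b (Suc k)) / 2 ^ Suc k)) \<le> 1"
proof -
  let ?f = "\<lambda>k. real (b (Suc k)) / 2 ^ Suc k"
  have sum: "summable (\<lambda>k. ?f (k + i))"
    using summable_b by (rule summable_ignore_initial_segment)
  have tail: "b_value - (\<Sum>k<i. ?f k) = (\<Sum>k. ?f (k + i))"
    using suminf_minus_initial_segment[OF summable_b, of i] by (simp add: b_value_def)
  show "0 \<le> 2 ^ i * (b_value - (\<Sum>k<i. ?f k))"
    unfolding tail by (intro mult_nonneg_nonneg suminf_nonneg sum) auto
  have geom: "(\<lambda>k. (1 / 2) ^ i * (1 / 2 :: real) ^ Suc k) sums ((1 / 2) ^ i * 1)"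
    by (intro sums_mult power_half_series)
  have "(\<Sum>k. ?f (k + i)) \<le> (\<Sum>k. (1 / 2) ^ i * (1 / 2 :: real) ^ Suc k)"
    by (intro suminf_le sum sums_summable[OF geom])
      (auto simp: b_def power_one_over power_add mult_ac)
  also have "\<dots> = 1 / 2 ^ i"
    unfolding sums_unique[OF geom, symmetric] by (simp add: power_one_over)
  finally show "2 ^ i * (b_value - (\<Sum>k<i. ?f k)) \<le> 1"
    unfolding tail by (simp add: field_simps)
qed

definition discrepancy :: "nat \<Rightarrow> real" where
  "discrepancy n = real (a n) - (2 - 2 * b_value) * real n"

lemma abs_discrepancy_le: "\<bar>discrepancy n\<bar> \<le> 2 * real n"
proof -
  have "0 \<le> b_value" "b_value \<le> 1"
    using b_value_truncation[of 0] by auto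
  then have "0 \<le> (2 - 2 * b_value) * real n" "(2 - 2 * b_value) * real n \<le> 2 * real n"
    by (auto intro: mult_right_mono)
  then show ?thesis
    using a_le[of n] unfolding discrepancy_def by linarith
qed

lemma abs_discrepancy_length_B_le:
  assumes "i \<ge> 1"
  shows "\<bar>discrepancy (length (B i))\<bar> \<le> 2 * real i + 3"
proof -
  let ?t = "2 ^ i * (b_value - (\<Sum>k<i. real (b (Suc k)) / 2 ^ Suc k))"
  obtain j where j: "i = Suc j"
    using assms by (cases i) auto
  \<comment> \<open>With length \<open>2 ^ j + j + 2 = 2 ^ i / 2 + i + 1\<close>, the exponential
    terms differ by \<open>?t\<close> in [0, 1]; the rest is \<open>discrepancy i\<close> and a term
    in [0, 2].\<close>
  have "discrepancy (length (B i)) = ?t + discrepancy i - (2 - 2 * b_value)"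
    unfolding discrepancy_def a_length_B[OF assms]
    by (simp add: j length_B_closed_form algebra_simps del: B.simps)
  then show ?thesis
    using b_value_truncation[of i] b_value_truncation[of 0] abs_discrepancy_le[of i] by simp
qed

lemma discrepancy_shift:
  assumes "i \<ge> 1" "i + m \<le> length (B i)"
  shows "discrepancy (length (B i) + m) =
    discrepancy (length (B i)) + discrepancy (i + m) - discrepancy i"
proof -
  have "real (a (length (B i) + m)) + real (a i) = real (a (length (B i))) + real (a (i + m))"
    using a_shift[OF assms] by linarith
  then show ?thesis
    by (simp add: discrepancy_def algebra_simps)
qed

lemma abs_discrepancy_le_square:
  assumes "i \<ge> 1" "n \<le> length (B i)"
  shows "\<bar>discrepancy n\<bar> \<le> 6 * (real i)\<^sup>2"
  using assms
proof (induction i arbitrary: n rule: dec_induct)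
  case base
  \<comment> \<open>Here \<open>n \<le> 3\<close>, so the trivial bound \<open>2 * n\<close> already
    gives the constant 6.\<close>
  then show ?case
    using abs_discrepancy_le[of n] by simp
next
  case (step i)
  \<comment> \<open>The extra cost is \<open>2 * i + 3\<close> for
    \<open>discrepancy (length (B i))\<close> plus \<open>2 * i\<close> for
    \<open>discrepancy i\<close>; the right side grows by \<open>12 * i + 6\<close>.\<close>
  have mono: "6 * (real i)\<^sup>2 + (4 * real i + 3) \<le> 6 * (real (Suc i))\<^sup>2"
    by (simp add: power2_eq_square algebra_simps)
  show ?case
  proof (cases "n \<le> length (B i)")
    case True
    then show ?thesis
      using step.IH[of n] mono by simp
  next
    case False
    define m where "m = n - length (B i)"
    have n: "n = length (B i) + m"
      using False by (simp add: m_def)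
    \<comment> \<open>The overhang \<open>m\<close> is at most \<open>length (drop i (B i))\<close>,
      so the induction hypothesis covers \<open>i + m\<close>.\<close>
    have m: "i + m \<le> length (B i)"
      using step.prems step.hyps B_rec[of i] False length_B[of i] by (simp add: m_def)
    have "discrepancy n = discrepancy (length (B i)) + discrepancy (i + m) - discrepancy i"
      unfolding n by (rule discrepancy_shift[OF step.hyps(1) m])
    then show ?thesis
      using step.IH[OF m] mono abs_discrepancy_length_B_le[OF step.hyps(1)] abs_discrepancy_le[of i]
      by linarith
  qed
qed

lemma abs_discrepancy_le_log:
  assumes "n \<ge> 1"
  shows "\<bar>discrepancy n\<bar> \<le> 6 * (log 2 (real n) + 2)\<^sup>2"
proof -
  \<comment> \<open>Chosen so that \<open>n \<le> 2 ^ j < length (B (Suc j))\<close>, while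
    \<open>Suc j\<close> stays below \<open>log 2 n + 2\<close> up to equality.\<close>
  define j where "j = nat \<lceil>log 2 (real n)\<rceil>"
  have log: "0 \<le> log 2 (real n)"
    using assms by simp
  then have j: "log 2 (real n) \<le> real j" "real j \<le> log 2 (real n) + 1"
    unfolding j_def by linarith+
  have "real n \<le> 2 ^ j"
    using j(1) assms by (simp add: log_le_iff powr_realpow)
  then have "n \<le> length (B (Suc j))"
    unfolding length_B_closed_form by simp
  then have "\<bar>discrepancy n\<bar> \<le> 6 * (real (Suc j))\<^sup>2"
    by (intro abs_discrepancy_le_square) simp
  also have "\<dots> \<le> 6 * (log 2 (real n) + 2)\<^sup>2"
    using j by (intro mult_left_mono power_mono) auto
  finally show ?thesis .
qed

theorem theorem10:
  shows "(\<lambda>n. real (a n) / real n) \<longlonglongrightarrow> 2 - 2 * (\<Sum>i. real (b (Suc i)) / 2 ^ Suc i)"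
proof -
  have "(\<lambda>n. real (a n) / real n - (2 - 2 * b_value)) \<longlonglongrightarrow> 0"
  proof (rule tendsto_0_le)
    show "\<forall>\<^sub>F n in sequentially. norm (real (a n) / real n - (2 - 2 * b_value)) \<le>
      norm (6 * (log 2 (real n) + 2)\<^sup>2 / real n) * 1"
    proof (rule eventually_sequentiallyI[of 1])
      fix n :: nat
      assume n: "1 \<le> n"
      then have "real (a n) / real n - (2 - 2 * b_value) = discrepancy n / real n"
        by (simp add: discrepancy_def field_simps)
      then show "norm (real (a n) / real n - (2 - 2 * b_value)) \<le>
        norm (6 * (log 2 (real n) + 2)\<^sup>2 / real n) * 1"
        using abs_discrepancy_le_log[OF n] by (simp add: divide_right_mono)
    qed
    show "(\<lambda>n. 6 * (log 2 (real n) + 2)\<^sup>2 / real n) \<longlonglongrightarrow> 0"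
      by real_asymp
  qed
  then show ?thesis
    unfolding b_value_def by (rule LIM_zero_cancel)
qed

end
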